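(* There exist a real $\alpha>0$ and an $n_0\in\mathbb{N}$ such that for every even $n\ge n_0$ there exists a $3$-regular graph on $n$ vertices for which $\alpha n$ cops are not enough to catch the robber, i.e. a $3$-regular graph $G$ on $n$ vertices with $\mathrm{ent}(G)>\alpha n$.
   Context: Graphs here are finite, simple and undirected. Entanglement game on a graph $G$ with $k$ cops: First the robber chooses a starting vertex, and all $k$ cops are outside the graph. In every turn, the cops either all stay where they are, or exactly one of them flies (from wherever it is, on or off the graph) to the current position of the robber. Regardless of which of these happened, the robber then has to move to a neighbor of his current position that is not occupied by a cop. If there is no such neighbor, the cops win. The robber wins if he can run away indefinitely. Both sides have full information. The entanglement number $\mathrm{ent}(G)$ is the minimal integer $k$ such that $k$ cops have a strategy to catch the robber on $G$. "$\alpha n$ cops are not enough" means that no integer number $k\le\alpha n$ of cops can catch the robber, i.e. $\mathrm{ent}(G)>\alpha n$. *)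

theory Defs
  imports Complex_Main "Graph_Theory.Pair_Digraph"
begin

text \<open>
  A finite simple undirected graph is a \<^locale>\<open>pair_graph\<close>: a finite loop-free digraph whose arcs
  are pairs of vertices and form a symmetric relation, each edge being represented by its two
  orientations. The degree of a vertex is then its out-degree.
\<close>

definition regular_graph :: "nat \<Rightarrow> 'a pair_pre_digraph \<Rightarrow> bool" where
  "regular_graph d G \<longleftrightarrow>
     pair_graph G \<and> (\<forall>v \<in> pverts G. out_degree (with_proj G) v = d)"

text \<open>
  The cops are numbered \<open>0, \<dots>, k - 1\<close>. A placement maps each cop to its vertex,
  or to \<open>None\<close> if the cop is outside the graph. A cop move is \<open>None\<close> (all cops stay) or
  \<open>Some i\<close> (cop \<open>i\<close> flies to the current position \<open>v\<close> of the robber).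
\<close>

type_synonym 'a placement = "nat \<Rightarrow> 'a option"

fun fly :: "nat option \<Rightarrow> 'a \<Rightarrow> 'a placement \<Rightarrow> 'a placement" where
  "fly None v c = c"
| "fly (Some i) v c = c(i := Some v)"

text \<open>
  A cop strategy chooses a move from the list of all robber positions so far, oldest first and
  ending with the current one. As the earlier cop moves are determined by the strategy, this is the
  full information about the play.
\<close>

type_synonym 'a cop_strategy = "'a list \<Rightarrow> nat option"

definition cop_strategy :: "nat \<Rightarrow> 'a cop_strategy \<Rightarrow> bool" where
  "cop_strategy k \<sigma> \<longleftrightarrow> (\<forall>h i. \<sigma> h = Some i \<longrightarrow> i < k)"

text \<open>
  The placement after \<open>t\<close> cop moves made according to \<open>\<sigma>\<close>, when the robber
  is on \<open>r s\<close> after his \<open>s\<close>-th move (and starts on \<open>r 0\<close>).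
\<close>

primrec cops_after :: "'a cop_strategy \<Rightarrow> (nat \<Rightarrow> 'a) \<Rightarrow> nat \<Rightarrow> 'a placement" where
  "cops_after \<sigma> r 0 = (\<lambda>_. None)"
| "cops_after \<sigma> r (Suc t) = fly (\<sigma> (map r [0..<Suc t])) (r t) (cops_after \<sigma> r t)"

text \<open>The robber runs away indefinitely along \<open>r\<close> from \<open>k\<close> cops that play \<open>\<sigma>\<close>.\<close>

definition escapes ::
  "'a pair_pre_digraph \<Rightarrow> nat \<Rightarrow> 'a cop_strategy \<Rightarrow> (nat \<Rightarrow> 'a) \<Rightarrow> bool" where
  "escapes G k \<sigma> r \<longleftrightarrow>
     r 0 \<in> pverts G \<and>
     (\<forall>t. (r t, r (Suc t)) \<in> parcs G \<and>
          (\<forall>i<k. cops_after \<sigma> r (Suc t) i \<noteq> Some (r (Suc t))))"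

text \<open>
  A play in which the robber does not run away indefinitely ends with him having no legal move,
  that is, with a win for the cops.
\<close>

definition cops_win :: "'a pair_pre_digraph \<Rightarrow> nat \<Rightarrow> bool" where
  "cops_win G k \<longleftrightarrow> (\<exists>\<sigma>. cop_strategy k \<sigma> \<and> \<not> (\<exists>r. escapes G k \<sigma> r))"

definition ent :: "'a pair_pre_digraph \<Rightarrow> nat" where
  "ent G = (LEAST k. cops_win G k)"

text \<open>The minimum exists: with one cop per vertex, the cops can keep every visited vertex occupied.\<close>

lemma cops_win_card:
  assumes "pair_graph G"
  shows "cops_win G (card (pverts G))"
proof -
  interpret pair_graph G by fact
  let ?n = "card (pverts G)"
  define \<sigma> where "\<sigma> h = (if h \<noteq> [] \<and> length h \<le> ?n then Some (length h - 1) else None)"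
    for h :: "'a list"
  have strat: "cop_strategy ?n \<sigma>"
    by (auto simp: cop_strategy_def \<sigma>_def neq_Nil_conv)
  have False if esc: "escapes G ?n \<sigma> r" for r
  proof -
    have step: "(r t, r (Suc t)) \<in> parcs G"
      and free: "i < ?n \<Longrightarrow> cops_after \<sigma> r (Suc t) i \<noteq> Some (r (Suc t))" for t i
      using esc by (auto simp: escapes_def simp del: cops_after.simps)
    have inV: "r t \<in> pverts G" for t
      using step[of t] by (rule in_arcsD1)
    have mv: "\<sigma> (map r [0..<Suc t]) = (if t < ?n then Some t else None)" for t
      by (auto simp: \<sigma>_def)
    have occ: "cops_after \<sigma> r t i = Some (r i)" if "i < t" "i < ?n" for t i
      using that
    proof (induction t)
      case 0
      then show ?case by simp
    next
      case (Suc t)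
      then show ?case
        unfolding cops_after.simps mv by (cases "i = t") auto
    qed
    have "inj_on r {..?n}"
    proof (rule linorder_inj_onI)
      fix s t :: nat
      assume "s < t" "s \<in> {..?n}" "t \<in> {..?n}"
      then show "r s \<noteq> r t"
        using occ[of s t] free[of s "t - 1"] by (cases t) auto
    qed auto
    then have "card {..?n} \<le> ?n"
      using inV pair_finite_verts by (intro card_inj_on_le) auto
    then show False by simp
  qed
  with strat show ?thesis
    by (auto simp: cops_win_def)
qed

end

theory Submission
  imports Defs "HOL-Combinatorics.Permutations"
begin

text \<open>
  The graph is a Hamilton cycle on \<open>2 * h\<close> vertices together with a perfect matching between its two
  halves. Each half contains \<open>4 * s\<close> disjoint arcs of the cycle (clusters), and the matching is chosen
  such that any \<open>s\<close> clusters of the first half are joined to any \<open>s\<close> clusters of the second half.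
  A random function from matching edges to clusters of the second half achieves this by a union bound;
  ordering the vertices of the second half by the value of the function makes its clusters contiguous.
  After deleting a set \<open>C\<close> of at most \<open>s / 2\<close> vertices, the unions of components that contain \<open>s\<close>
  clusters are closed under intersection, so there is a least one, \<open>haven C\<close>. It shrinks when \<open>C\<close>
  grows, and a robber in \<open>haven C\<close> who sees a cop fly to his vertex \<open>v\<close> has a neighbour in
  \<open>haven (insert v C)\<close>, since otherwise the latter would be a large union of components of the graph
  without \<open>C\<close> that misses \<open>v\<close>. So \<open>s / 2 - 1\<close> cops never catch him.
\<close>

subsection \<open>Havens\<close>

definition occupied :: "nat \<Rightarrow> 'a placement \<Rightarrow> 'a set" where
  "occupied k c = {v. \<exists>i<k. c i = Some v}"

lemma occupied_subset_image: "occupied k c \<subseteq> (\<lambda>i. the (c i)) ` {..<k}"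
  by (force simp: occupied_def)

lemma finite_occupied: "finite (occupied k c)"
  using occupied_subset_image by (rule finite_subset) simp

lemma card_occupied: "card (occupied k c) \<le> k"
  using surj_card_le[OF _ occupied_subset_image[of k c]] by simp

lemma occupied_fly: "occupied k (fly a v c) \<subseteq> insert v (occupied k c)"
  by (cases a) (auto simp: occupied_def split: if_splits)

text \<open>The robber stays in \<open>\<beta>\<close> of the occupied set. He moves into
  \<open>\<beta> (insert v C)\<close>, as if a cop had landed on \<open>v\<close> and none had left
  its place; whatever the cops really did, they occupy no further vertex, so antitonicity keeps him
  safe. The extra vertex \<open>v\<close> explains \<open>Suc k\<close>.\<close>

lemma not_cops_win_if_haven:
  fixes \<beta> :: "'a set \<Rightarrow> 'a set"
  assumes ne: "\<beta> {} \<noteq> {}"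
    and sub: "\<And>C. \<beta> C \<subseteq> pverts G - C"
    and step: "\<And>C v. \<lbrakk>finite C; card C \<le> k; v \<in> \<beta> C\<rbrakk> \<Longrightarrow> \<exists>u \<in> \<beta> (insert v C). (v, u) \<in> parcs G"
    and anti: "\<And>C D. \<lbrakk>finite D; card D \<le> Suc k; C \<subseteq> D\<rbrakk> \<Longrightarrow> \<beta> D \<subseteq> \<beta> C"
  shows "\<not> cops_win G k"
proof -
  have "\<exists>r. escapes G k \<sigma> r" for \<sigma>
  proof -
    define good where "good = (\<lambda>(h, c). h \<noteq> [] \<and> last h \<in> \<beta> (occupied k c))"
    define nxt where "nxt = (\<lambda>(h, c) (h', c'). \<exists>u. h' = h @ [u] \<and> (last h, u) \<in> parcs G \<and>
      c' = fly (\<sigma> h) (last h) c)"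
    obtain v0 where v0: "v0 \<in> \<beta> {}"
      using ne by blast
    \<comment> \<open>A state holds the history, which \<open>\<sigma>\<close> reads, and the
      placement. Pinning the state at time 0 gives \<open>hist\<close> below its base case.\<close>
    define good' where "good' = (\<lambda>(t::nat) p. good p \<and> (t = 0 \<longrightarrow> p = ([v0], \<lambda>_. None)))"
    have "\<exists>P. \<forall>t. good' t (P t) \<and> nxt (P t) (P (Suc t))"
    proof (rule dependent_nat_choice)
      show "\<exists>p. good' 0 p"
        using v0 by (auto simp: good'_def good_def occupied_def)
    next
      fix p t assume "good' t p"
      then have "good p" by (simp add: good'_def)
      obtain h c where p: "p = (h, c)" by force
      have h: "h \<noteq> []" "last h \<in> \<beta> (occupied k c)"
        using \<open>good p\<close> by (auto simp: good_def p)
      obtain u where u: "u \<in> \<beta> (insert (last h) (occupied k c))" "(last h, u) \<in> parcs G"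
        using step[OF finite_occupied card_occupied h(2)] by blast
      have "card (insert (last h) (occupied k c)) \<le> Suc k"
        using card_occupied[of k c] by (simp add: card_insert_if finite_occupied)
      then have "u \<in> \<beta> (occupied k (fly (\<sigma> h) (last h) c))"
        using anti[OF _ _ occupied_fly] u(1) finite_occupied by blast
      then show "\<exists>q. good' (Suc t) q \<and> nxt p q"
        using u by (intro exI[of _ "(h @ [u], fly (\<sigma> h) (last h) c)"])
          (auto simp: good'_def good_def nxt_def p)
    qed
    then obtain P where P: "\<And>t. good' t (P t)" "\<And>t. nxt (P t) (P (Suc t))"
      by blast
    define r where "r t = last (fst (P t))" for t
    have hist: "P t = (map r [0..<Suc t], cops_after \<sigma> r t)" for t
    proof (induction t)
      case 0
      have "P 0 = ([v0], \<lambda>_. None)" using P(1)[of 0] by (simp add: good'_def)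
      then show ?case by (simp add: r_def)
    next
      case (Suc t)
      have "r (Suc t) = last (fst (P (Suc t)))" "r t = last (fst (P t))"
        by (simp_all add: r_def)
      then show ?case
        using P(2)[of t] unfolding Suc nxt_def by (auto split: prod.splits)
    qed
    have in_haven: "r t \<in> \<beta> (occupied k (cops_after \<sigma> r t))" for t
      using P(1)[of t] unfolding hist good'_def good_def by auto
    have "(r t, r (Suc t)) \<in> parcs G" for t
      using P(2)[of t] unfolding hist nxt_def by auto
    moreover have "cops_after \<sigma> r t i \<noteq> Some (r t)" if "i < k" for t i
      using in_haven[of t] sub that by (fastforce simp: occupied_def)
    moreover have "r 0 \<in> pverts G"
      using in_haven[of 0] sub by blast
    ultimately have "escapes G k \<sigma> r"
      unfolding escapes_def by blast
    then show ?thesis by blast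
  qed
  then show ?thesis
    by (auto simp: cops_win_def)
qed

subsection \<open>A haven from two linked families of clusters\<close>

text \<open>These are the unions of connected components of the graph without
  \<open>C\<close>.\<close>

definition closed_off :: "'a pair_pre_digraph \<Rightarrow> 'a set \<Rightarrow> 'a set \<Rightarrow> bool" where
  "closed_off G C X \<longleftrightarrow> X \<subseteq> pverts G - C \<and> (\<forall>x y. (x, y) \<in> parcs G \<longrightarrow> x \<in> X \<longrightarrow> y \<notin> C \<longrightarrow> y \<in> X)"

definition inside :: "nat \<Rightarrow> (nat \<Rightarrow> 'a set) \<Rightarrow> 'a set \<Rightarrow> nat set" where
  "inside m A X = {i. i < m \<and> A i \<subseteq> X}"

lemma inside_subset: "inside m A X \<subseteq> {..<m}"
  by (auto simp: inside_def)

lemma finite_inside [simp]: "finite (inside m A X)"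
  by (rule finite_subset[OF inside_subset]) simp

lemma card_meeting_le:
  assumes "disjoint_family_on A I" "finite C"
  shows "card {i \<in> I. A i \<inter> C \<noteq> {}} \<le> card C"
proof -
  define g where "g x = (THE i. i \<in> I \<and> x \<in> A i)" for x
  have g: "g x = i" if "i \<in> I" "x \<in> A i" for i x
    unfolding g_def using that assms(1) by (intro the_equality) (auto simp: disjoint_family_on_def)
  have "{i \<in> I. A i \<inter> C \<noteq> {}} \<subseteq> g ` C"
    using g by force
  then show ?thesis
    using assms(2) surj_card_le by blast
qed

text \<open>Deleting few vertices leaves most clusters intact, and each of these lies inside or outside of
  a closed set. A closed set containing a quarter of the clusters of one family therefore
  contains most clusters of the other one, as otherwise the two quarters would be unlinked.\<close>

lemma inside_other_family:
  assumes disj: "disjoint_family_on B {..<4*s}"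
    and conn: "\<And>j. \<lbrakk>j < 4*s; B j \<inter> C = {}; B j \<inter> X \<noteq> {}\<rbrakk> \<Longrightarrow> B j \<subseteq> X"
    and link: "\<And>S T. \<lbrakk>S \<subseteq> {..<4*s}; T \<subseteq> {..<4*s}; s \<le> card S; s \<le> card T\<rbrakk>
      \<Longrightarrow> \<exists>i\<in>S. \<exists>j\<in>T. \<exists>x\<in>A i. \<exists>y\<in>B j. (x, y) \<in> parcs G"
    and cl: "closed_off G C X" and fin: "finite C"
    and big: "s \<le> card (inside (4*s) A X)"
  shows "3 * s < card (inside (4*s) B X) + card C"
proof -
  define M where "M = {j\<in>{..<4*s}. B j \<inter> C \<noteq> {}}"
  define T where "T = {j\<in>{..<4*s}. B j \<inter> C = {} \<and> B j \<inter> X = {}}"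
  have "{..<4*s} \<subseteq> inside (4*s) B X \<union> (M \<union> T)"
    using conn by (auto simp: inside_def M_def T_def)
  then have "card {..<4*s} \<le> card (inside (4*s) B X \<union> (M \<union> T))"
    by (intro card_mono) (auto simp: M_def T_def)
  also have "\<dots> \<le> card (inside (4*s) B X) + (card M + card T)"
    by (meson card_Un_le add_left_mono le_trans)
  finally have *: "4 * s \<le> card (inside (4*s) B X) + (card M + card T)" by simp
  have "\<not> s \<le> card T"
  proof
    assume "s \<le> card T"
    then obtain i j x y where "i \<in> inside (4*s) A X" "j \<in> T" "x \<in> A i" "y \<in> B j" "(x, y) \<in> parcs G"
      using link[OF inside_subset _ big, of T] unfolding T_def by blast
    moreover from this have "x \<in> X" "y \<notin> C" "y \<notin> X"
      by (auto simp: inside_def T_def)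
    ultimately show False
      using cl by (auto simp: closed_off_def)
  qed
  moreover have "card M \<le> card C"
    unfolding M_def using disj fin by (rule card_meeting_le)
  ultimately show ?thesis
    using * by linarith
qed

text \<open>\<open>connA\<close> and \<open>connB\<close> express connectedness of the clusters
  through closed sets, the form in which it is used.\<close>

locale linked_families = pair_graph G for G :: "'a pair_pre_digraph" +
  fixes A B :: "nat \<Rightarrow> 'a set" and s :: nat
  assumes s_pos: "0 < s"
    and A_verts: "\<And>i. i < 4*s \<Longrightarrow> A i \<subseteq> pverts G"
    and disjA: "disjoint_family_on A {..<4*s}"
    and disjB: "disjoint_family_on B {..<4*s}"
    and connA: "\<And>i C X. \<lbrakk>closed_off G C X; i < 4*s; A i \<inter> C = {}; A i \<inter> X \<noteq> {}\<rbrakk> \<Longrightarrow> A i \<subseteq> X"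
    and connB: "\<And>j C X. \<lbrakk>closed_off G C X; j < 4*s; B j \<inter> C = {}; B j \<inter> X \<noteq> {}\<rbrakk> \<Longrightarrow> B j \<subseteq> X"
    and link: "\<And>S T. \<lbrakk>S \<subseteq> {..<4*s}; T \<subseteq> {..<4*s}; s \<le> card S; s \<le> card T\<rbrakk>
      \<Longrightarrow> \<exists>i\<in>S. \<exists>j\<in>T. \<exists>x\<in>A i. \<exists>y\<in>B j. (x, y) \<in> parcs G"
begin

section \<open>Large closed sets and the least one among them\<close>

definition big :: "'a set \<Rightarrow> 'a set \<Rightarrow> bool" where
  "big C X \<longleftrightarrow> closed_off G C X \<and> s \<le> card (inside (4*s) A X)"

text \<open>The factor \<open>pverts G - C\<close> keeps the value off \<open>C\<close> even when
  \<open>C\<close> is so large that no set is big and the intersection is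
  \<open>UNIV\<close>.\<close>

definition haven :: "'a set \<Rightarrow> 'a set" where
  "haven C = (pverts G - C) \<inter> \<Inter>{X. big C X}"

text \<open>Linking is used twice: \<open>s\<close> clusters of \<open>A\<close> force most clusters
  of \<open>B\<close>, in particular \<open>s\<close> of them, and these force most clusters of
  \<open>A\<close>.\<close>

lemma card_inside_big:
  assumes "big C X" "finite C" "2 * card C \<le> s"
  shows "3 * s < card (inside (4*s) A X) + card C"
proof -
  have cl: "closed_off G C X" and "s \<le> card (inside (4*s) A X)"
    using assms(1) by (auto simp: big_def)
  then have "3 * s < card (inside (4*s) B X) + card C"
    using inside_other_family[OF disjB connB[OF cl] link cl assms(2)] by blast
  then have *: "s \<le> card (inside (4*s) B X)"
    using assms(3) by linarith
  have link': "\<exists>j\<in>S. \<exists>i\<in>T. \<exists>y\<in>B j. \<exists>x\<in>A i. (y, x) \<in> parcs G"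
    if "S \<subseteq> {..<4*s}" "T \<subseteq> {..<4*s}" "s \<le> card S" "s \<le> card T" for S T
    using link[OF that(2,1,4,3)] arcs_symmetric by blast
  show ?thesis
    using inside_other_family[OF disjA connA[OF cl] link' cl assms(2) *] by blast
qed

text \<open>Each of the two sets contains more than \<open>5/2 * s\<close> of the
  \<open>4 * s\<close> clusters, so they share more than \<open>s\<close>.\<close>

lemma big_Int:
  assumes "big C X" "big C Y" "finite C" "2 * card C \<le> s"
  shows "big C (X \<inter> Y)"
proof -
  let ?I = "inside (4*s) A X" and ?J = "inside (4*s) A Y"
  have "card (?I \<union> ?J) \<le> card {..<4*s}"
    by (intro card_mono) (auto simp: inside_def)
  moreover have "card ?I + card ?J = card (?I \<union> ?J) + card (?I \<inter> ?J)"
    by (rule card_Un_Int) auto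
  moreover have "inside (4*s) A (X \<inter> Y) = ?I \<inter> ?J"
    by (auto simp: inside_def)
  ultimately have "s \<le> card (inside (4*s) A (X \<inter> Y))"
    using card_inside_big[OF assms(1,3,4)] card_inside_big[OF assms(2,3,4)] assms(4) by simp
  moreover have "closed_off G C (X \<inter> Y)"
    using assms(1,2) by (auto simp: big_def closed_off_def)
  ultimately show ?thesis
    by (simp add: big_def)
qed

text \<open>By disjointness, deleting \<open>D\<close> damages at most \<open>card D\<close>
  clusters.\<close>

lemma big_Diff:
  assumes "closed_off G C X" "C \<subseteq> D" "finite D" "s + card D \<le> card (inside (4*s) A X)"
  shows "big D (X - D)"
proof -
  let ?M = "{i\<in>{..<4*s}. A i \<inter> D \<noteq> {}}"
  have "inside (4*s) A X \<subseteq> inside (4*s) A (X - D) \<union> ?M"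
    by (auto simp: inside_def)
  then have "card (inside (4*s) A X) \<le> card (inside (4*s) A (X - D) \<union> ?M)"
    by (intro card_mono) auto
  also have "\<dots> \<le> card (inside (4*s) A (X - D)) + card ?M"
    by (rule card_Un_le)
  finally have "s \<le> card (inside (4*s) A (X - D))"
    using card_meeting_le[OF disjA assms(3)] assms(4) by linarith
  moreover have "closed_off G D (X - D)"
    using assms(1,2) by (auto simp: closed_off_def)
  ultimately show ?thesis
    by (simp add: big_def)
qed

lemma big_haven:
  assumes "finite C" "2 * card C \<le> s"
  shows "big C (haven C)"
proof -
  have "inside (4*s) A (pverts G) = {..<4*s}"
    using A_verts by (auto simp: inside_def)
  then have top: "big C (pverts G - C)"
    using assms by (intro big_Diff[where C = "{}"]) (auto simp: closed_off_def in_arcsD2)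
  \<comment> \<open>With finitely many big sets, pairwise intersection suffices; the induction
    starts from \<open>pverts G - C\<close>.\<close>
  have fin: "finite {X. big C X}"
    by (rule finite_subset[of _ "Pow (pverts G)"])
      (use pair_finite_verts in \<open>auto simp: big_def closed_off_def\<close>)
  have "big C ((pverts G - C) \<inter> \<Inter>F)" if "finite F" "F \<subseteq> {X. big C X}" for F
    using that
  proof (induction F)
    case (insert X F)
    have "big C (((pverts G - C) \<inter> \<Inter>F) \<inter> X)"
      by (rule big_Int[OF _ _ assms]) (use insert in auto)
    moreover have "(pverts G - C) \<inter> \<Inter>F \<inter> X = (pverts G - C) \<inter> \<Inter>(insert X F)"
      by blast
    ultimately show ?case by simp
  qed (use top in auto)
  then show ?thesis
    unfolding haven_def using fin by blast
qed

text \<open>A set that is big for \<open>C\<close> has so many clusters to spare that it stays big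
  after deleting \<open>D\<close>, hence contains \<open>haven D\<close>.\<close>

lemma haven_antimono:
  assumes "finite D" "2 * card D \<le> s" "C \<subseteq> D"
  shows "haven D \<subseteq> haven C"
proof -
  have C: "finite C" "card C \<le> card D"
    using assms finite_subset card_mono by blast+
  have "haven D \<subseteq> X" if "big C X" for X
  proof -
    have "3 * s < card (inside (4*s) A X) + card C"
      using that C assms(2) by (intro card_inside_big) auto
    then have "big D (X - D)"
      using that C assms by (intro big_Diff[of C]) (auto simp: big_def)
    then show ?thesis by (auto simp: haven_def)
  qed
  then show ?thesis
    using assms(3) by (auto simp: haven_def)
qed

lemma haven_step:
  assumes "finite C" "2 * Suc (card C) \<le> s" "v \<in> haven C"
  shows "\<exists>u\<in>haven (insert v C). (v, u) \<in> parcs G"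
proof (rule ccontr)
  assume no: "\<not> ?thesis"
  have b: "big (insert v C) (haven (insert v C))"
    using assms by (intro big_haven) (auto simp: card_insert_if)
  have "(x, v) \<notin> parcs G" if "x \<in> haven (insert v C)" for x
    using no that arcs_symmetric by blast
  \<comment> \<open>With no arc to \<open>v\<close>, the set remains closed when \<open>v\<close> is
    put back into the graph.\<close>
  then have "big C (haven (insert v C))"
    using b by (auto simp: big_def closed_off_def)
  then have "v \<in> haven (insert v C)"
    using assms(3) by (auto simp: haven_def)
  then show False by (simp add: haven_def)
qed

lemma not_cops_win:
  assumes "2 * Suc k \<le> s"
  shows "\<not> cops_win G k"
proof (rule not_cops_win_if_haven)
  let ?I = "inside (4*s) A (haven {})"
  have "s \<le> card ?I"
    using big_haven[of "{}"] by (simp add: big_def)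
  \<comment> \<open>Linking also supplies a vertex in one of these clusters.\<close>
  then obtain i x where "i \<in> ?I" "x \<in> A i"
    using link[OF inside_subset inside_subset] by blast
  then show "haven {} \<noteq> {}"
    by (auto simp: inside_def)
qed (use assms haven_step haven_antimono in \<open>auto simp: haven_def\<close>)

end


subsection \<open>Linking by a random function\<close>

text \<open>There are at most \<open>2\<^sup>8\<^sup>s = 256\<^sup>s\<close> pairs \<open>(S, T)\<close>, and each is unlinked with probability
  \<open>(3/4)\<^sup>2\<^sup>0\<^sup>s\<close>. The outdegree \<open>20\<close> is the least one that makes \<open>256 * (3/4)\<^sup>d < 1\<close>.\<close>

lemma exists_linking_function_on_pairs:
  assumes "0 < s"
  shows "\<exists>f \<in> {..<4*s} \<times> {..<20} \<rightarrow> {..<4*s}. \<forall>S T. S \<subseteq> {..<4*s} \<longrightarrow> T \<subseteq> {..<4*s} \<longrightarrow> card S = s \<longrightarrow>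
     card T = s \<longrightarrow> (\<exists>i\<in>S. \<exists>j<20::nat. f (i, j) \<in> T)" (is "\<exists>f \<in> _. ?linking f")
proof (rule ccontr)
  assume no: "\<not> ?thesis"
  let ?M = "{..<4*s}" and ?D = "{..<4*s} \<times> {..<20::nat}"
  let ?F = "?D \<rightarrow>\<^sub>E ?M"
  define Q where "Q = {S. S \<subseteq> ?M \<and> card S = s}"
  \<comment> \<open>\<open>bad S T\<close> holds the functions that leave the pair unlinked. For one
    cluster, \<open>a\<close> counts all choices of its 20 values and \<open>b\<close> those
    avoiding a \<open>T\<close> of size \<open>s\<close>.\<close>
  define bad where "bad S T = (\<Pi>\<^sub>E p\<in>?D. if fst p \<in> S then ?M - T else ?M)" for S T
  define a b where "a = (4*s)^20" and "b = (3*s)^20"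
  have finQ: "finite Q" by (rule finite_subset[of _ "Pow ?M"]) (auto simp: Q_def)
  have "card Q \<le> card (Pow ?M)" by (rule card_mono) (auto simp: Q_def)
  then have cQ: "card Q \<le> 2^(4*s)" by (simp add: card_Pow)
  have card_bad: "card (bad S T) = b^s * a^(3*s)" if "S \<in> Q" "T \<in> Q" for S T
  proof -
    have S: "S \<subseteq> ?M" "card S = s" and T: "T \<subseteq> ?M" "card T = s"
      using that by (auto simp: Q_def)
    have "finite T" using T(1) finite_subset by blast
    have cT: "card (?M - T) = 3*s"
      using T by (simp add: card_Diff_subset[OF \<open>finite T\<close>])
    have "card (bad S T) = (\<Prod>p\<in>?D. card (if fst p \<in> S then ?M - T else ?M))"
      unfolding bad_def by (rule card_PiE) simp
    also have "\<dots> = (\<Prod>p\<in>?D. if fst p \<in> S then 3*s else 4*s)"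
      by (intro prod.cong) (auto simp: cT)
    also have "\<dots> = (\<Prod>i\<in>?M. \<Prod>j\<in>{..<20::nat}. if i \<in> S then 3*s else 4*s)"
      by (subst prod.cartesian_product) (simp add: case_prod_beta)
    also have "\<dots> = (\<Prod>i\<in>?M. if i \<in> S then b else a)"
      by (intro prod.cong) (auto simp: a_def b_def)
    also have "\<dots> = b ^ card (?M \<inter> S) * a ^ card (?M \<inter> - S)"
      by (simp add: prod.If_cases)
    also have "?M \<inter> S = S" using S by blast
    also have "?M \<inter> - S = ?M - S" by blast
    also have "card (?M - S) = 3*s"
      using S finite_subset[OF S(1)] by (simp add: card_Diff_subset)
    finally show ?thesis using S by simp
  qed
  \<comment> \<open>If no function links, every function is bad for some pair, and the union bound
    applies.\<close>
  have "?F \<subseteq> (\<Union>p\<in>Q\<times>Q. bad (fst p) (snd p))"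
  proof
    fix f assume f: "f \<in> ?F"
    then have "f \<in> ?D \<rightarrow> ?M" by auto
    have "\<not> ?linking f"
      using no bexI[of ?linking, OF _ \<open>f \<in> ?D \<rightarrow> ?M\<close>] by (rule contrapos_nn)
    then obtain S T where ST: "S \<in> Q" "T \<in> Q" "\<forall>i\<in>S. \<forall>j<20::nat. f (i, j) \<notin> T"
      unfolding Q_def by auto
    then have "f \<in> bad S T"
      using f unfolding bad_def by (auto simp: PiE_iff)
    with ST show "f \<in> (\<Union>p\<in>Q\<times>Q. bad (fst p) (snd p))" by force
  qed
  then have "card ?F \<le> card (\<Union>p\<in>Q\<times>Q. bad (fst p) (snd p))"
    by (rule card_mono[rotated]) (auto simp: bad_def finQ intro!: finite_PiE)
  also have "\<dots> \<le> (\<Sum>p\<in>Q\<times>Q. card (bad (fst p) (snd p)))"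
    by (rule card_UN_le) (simp add: finQ)
  also have "\<dots> = (\<Sum>p\<in>Q\<times>Q. b^s * a^(3*s))"
    using card_bad by (intro sum.cong) auto
  also have "\<dots> = (card Q * card Q) * (b^s * a^(3*s))"
    by (simp only: sum_constant card_cartesian_product of_nat_id)
  also have "\<dots> \<le> (2^(4*s) * 2^(4*s)) * (b^s * a^(3*s))"
    by (intro mult_right_mono mult_mono cQ) auto
  also have "(2::nat)^(4*s) * 2^(4*s) = 256^s"
    by (simp add: power_mult flip: power_mult_distrib)
  finally have "card ?F \<le> (256*b)^s * a^(3*s)"
    by (simp add: power_mult_distrib)
  also have "card ?F = (4*s)^(4*s*20)"
    by (simp add: card_PiE card_cartesian_product)
  also have "4*s*20 = 20 * (s + 3*s)" by simp
  also have "(4*s)^(20 * (s + 3*s)) = a^(s + 3*s)"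
    by (simp only: a_def power_mult)
  finally have "a^s * a^(3*s) \<le> (256*b)^s * a^(3*s)"
    by (simp only: power_add)
  moreover have "0 < a^(3*s)" using assms by (simp add: a_def)
  ultimately have "a^s \<le> (256*b)^s" by (simp only: mult_le_cancel2)
  moreover have "256*b < a"
    using assms by (simp add: a_def b_def power_mult_distrib)
  then have "(256*b)^s < a^s"
    using assms by (intro power_strict_mono) auto
  ultimately show False by simp
qed

text \<open>Writing \<open>x = 20 * i + j\<close> for edge \<open>j\<close> of cluster
  \<open>i\<close> turns the clusters of the first half into blocks of consecutive numbers.\<close>

lemma exists_linking_function:
  assumes "0 < s"
  obtains f where "f \<in> {..<80*s} \<rightarrow> {..<4*s}"
    and "\<And>S T. \<lbrakk>S \<subseteq> {..<4*s}; T \<subseteq> {..<4*s}; s \<le> card S; s \<le> card T\<rbrakk> \<Longrightarrow>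
      \<exists>x<80*s. x div 20 \<in> S \<and> f x \<in> T"
proof -
  obtain F where F: "F \<in> {..<4*s} \<times> {..<20} \<rightarrow> {..<4*s}"
    and link: "\<And>S T. S \<subseteq> {..<4*s} \<Longrightarrow> T \<subseteq> {..<4*s} \<Longrightarrow> card S = s \<Longrightarrow> card T = s \<Longrightarrow>
      \<exists>i\<in>S. \<exists>j<20::nat. F (i, j) \<in> T"
    using exists_linking_function_on_pairs[OF assms] by blast
  show ?thesis
  proof
    show "(\<lambda>x. F (x div 20, x mod 20)) \<in> {..<80*s} \<rightarrow> {..<4*s}"
      using F by (auto simp: Pi_iff)
  next
    fix S T assume ST: "S \<subseteq> {..<4*s}" "T \<subseteq> {..<4*s}" "s \<le> card S" "s \<le> card T"
    obtain S' T' where "S' \<subseteq> S" "card S' = s" "T' \<subseteq> T" "card T' = s"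
      using obtain_subset_with_card_n ST(3,4) by metis
    then obtain i j where ij: "i \<in> S" "j < 20" "F (i, j) \<in> T"
      using link[of S' T'] ST(1,2) by blast
    have "20 * i + j < 80 * s" using ij ST(1) by force
    with ij show "\<exists>x<80*s. x div 20 \<in> S \<and> F (x div 20, x mod 20) \<in> T"
      by (intro exI[of _ "20 * i + j"]) auto
  qed
qed

text \<open>Sorting by \<open>f\<close> makes every fibre of \<open>f\<close> an interval of
  positions.\<close>

lemma exists_sorting_permutation:
  fixes f :: "nat \<Rightarrow> 'b :: linorder"
  obtains \<tau> where "\<tau> permutes {..<N}" "mono_on {..<N} (f \<circ> \<tau>)"
proof
  define xs where "xs = sort_key f [0..<N]"
  define \<tau> where "\<tau> p = (if p < N then xs ! p else p)" for p
  have xs: "length xs = N" "distinct xs" "set xs = {..<N}" "sorted (map f xs)"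
    by (auto simp: xs_def)
  have "bij_betw (\<lambda>p. xs ! p) {..<N} {..<N}"
    using xs by (intro bij_betw_nth) auto
  then have "bij_betw \<tau> {..<N} {..<N}"
    by (rule bij_betw_cong[THEN iffD1, rotated]) (simp add: \<tau>_def)
  then show "\<tau> permutes {..<N}"
    by (rule bij_imp_permutes) (simp add: \<tau>_def)
  show "mono_on {..<N} (f \<circ> \<tau>)"
    using xs sorted_nth_mono[OF xs(4)] by (intro mono_onI) (simp add: \<tau>_def)
qed

subsection \<open>A Hamilton cycle with a perfect matching\<close>

text \<open>Position \<open>p\<close> of the second half is the vertex \<open>h + p\<close>, with
  partner \<open>\<tau> p\<close> in the first half; hence the inverse in the other
  direction.\<close>

definition matched :: "nat \<Rightarrow> (nat \<Rightarrow> nat) \<Rightarrow> nat \<Rightarrow> nat" where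
  "matched h \<tau> x = (if x < h then h + inv \<tau> x else \<tau> (x - h))"

definition nbrs :: "nat \<Rightarrow> (nat \<Rightarrow> nat) \<Rightarrow> nat \<Rightarrow> nat set" where
  "nbrs h \<tau> x = {if Suc x = 2*h then 0 else Suc x, if x = 0 then 2*h - 1 else x - 1, matched h \<tau> x}"

definition cycle_matching_graph :: "nat \<Rightarrow> (nat \<Rightarrow> nat) \<Rightarrow> nat pair_pre_digraph" where
  "cycle_matching_graph h \<tau> = \<lparr>pverts = {..<2*h}, parcs = {(x, y). x < 2*h \<and> y \<in> nbrs h \<tau> x}\<rparr>"

lemma matched_less:
  assumes "\<tau> permutes {..<h}" "x < 2*h"
  shows "matched h \<tau> x < 2*h"
  using permutes_in_image[OF assms(1), of "x - h"] permutes_in_image[OF permutes_inv[OF assms(1)], of x]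
    assms(2) by (auto simp: matched_def)

lemma matched_matched:
  assumes "\<tau> permutes {..<h}" "x < 2*h"
  shows "matched h \<tau> (matched h \<tau> x) = x"
  using permutes_in_image[OF assms(1), of "x - h"] permutes_inverses[OF assms(1)]
    assms(2) by (auto simp: matched_def)

text \<open>The fixed point \<open>h - 1\<close> of the permutation keeps the matching edges off the
  cycle edges \<open>{h - 1, h}\<close> and \<open>{2 * h - 1, 0}\<close>.\<close>

lemma card_nbrs:
  assumes "\<tau> permutes {..<h}" "1 < h" "\<tau> (h - 1) = h - 1" "x < 2*h"
  shows "x \<notin> nbrs h \<tau> x" "card (nbrs h \<tau> x) = 3"
proof -
  let ?s = "if Suc x = 2*h then 0 else Suc x" and ?p = "if x = 0 then 2*h - 1 else x - 1"
  have inv: "inv \<tau> (h - 1) = h - 1"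
    using assms(1,3) by (metis permutes_inverses(2))
  have fix_only: "\<tau> y = h - 1 \<longleftrightarrow> y = h - 1" "inv \<tau> y = h - 1 \<longleftrightarrow> y = h - 1" for y
    using assms(1,3) inv by (metis permutes_inverses)+
  have less: "\<tau> (x - h) < h" if "h \<le> x"
    using permutes_in_image[OF assms(1), of "x - h"] assms(4) that by auto
  have less': "inv \<tau> x < h" if "x < h"
    using permutes_in_image[OF permutes_inv[OF assms(1)], of x] that by auto
  have "matched h \<tau> x \<noteq> ?s \<and> matched h \<tau> x \<noteq> ?p \<and> matched h \<tau> x \<noteq> x"
  proof (cases "x < h")
    case True
    have "inv \<tau> 0 \<noteq> h - 1" using fix_only(2)[of 0] assms(2) by simp
    with True show ?thesis
      using less' inv assms(2) by (cases "x = h - 1") (auto simp: matched_def)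
  next
    case False
    have "\<tau> 0 \<noteq> h - 1" using fix_only(1)[of 0] assms(2) by simp
    have "\<tau> (x - h) \<noteq> 0" if "Suc x = 2*h"
    proof -
      have "x - h = h - 1" using that by linarith
      then show ?thesis using assms(2,3) by simp
    qed
    moreover have "\<tau> (x - h) \<noteq> x - 1"
    proof (cases "x = h")
      case True
      then show ?thesis using \<open>\<tau> 0 \<noteq> h - 1\<close> by simp
    next
      case ne: False
      then show ?thesis using False less by linarith
    qed
    ultimately show ?thesis
      using False less assms(2) by (auto simp: matched_def)
  qed
  moreover have "?s \<noteq> ?p \<and> ?s \<noteq> x \<and> ?p \<noteq> x"
    using assms(2,4) by (auto split: if_splits)
  moreover have "x \<notin> {a, b, c} \<and> card {a, b, c} = 3"
    if "c \<noteq> a \<and> c \<noteq> b \<and> c \<noteq> x" "a \<noteq> b \<and> a \<noteq> x \<and> b \<noteq> x" for a b c :: nat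
    using that by auto
  ultimately have "x \<notin> nbrs h \<tau> x \<and> card (nbrs h \<tau> x) = 3"
    unfolding nbrs_def by blast
  then show "x \<notin> nbrs h \<tau> x" "card (nbrs h \<tau> x) = 3"
    by blast+
qed

lemma nbrs_sym:
  assumes "\<tau> permutes {..<h}" "x < 2*h" "y \<in> nbrs h \<tau> x"
  shows "y < 2*h" "x \<in> nbrs h \<tau> y"
proof -
  show "y < 2*h"
    using assms(2,3) matched_less[OF assms(1,2)] unfolding nbrs_def by (auto split: if_splits) presburger
  consider "y = matched h \<tau> x" | "y = (if Suc x = 2*h then 0 else Suc x)"
    | "y = (if x = 0 then 2*h - 1 else x - 1)"
    using assms(3) by (auto simp: nbrs_def)
  then show "x \<in> nbrs h \<tau> y"
  proof cases
    case 1
    then show ?thesis using matched_matched[OF assms(1,2)] by (simp add: nbrs_def)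
  qed (use assms(2) in \<open>auto simp: nbrs_def\<close>)
qed

lemma regular_cycle_matching_graph:
  assumes "\<tau> permutes {..<h}" "1 < h" "\<tau> (h - 1) = h - 1"
  shows "regular_graph 3 (cycle_matching_graph h \<tau>)"
proof -
  let ?G = "cycle_matching_graph h \<tau>"
  have arcs: "parcs ?G \<subseteq> {..<2*h} \<times> {..<2*h}"
    using nbrs_sym(1)[OF assms(1)] by (auto simp: cycle_matching_graph_def)
  have "finite (parcs ?G)"
    using arcs by (rule finite_subset) simp
  moreover have "sym (parcs ?G)"
    using nbrs_sym[OF assms(1)] by (auto simp: cycle_matching_graph_def intro!: symI)
  moreover have "fst e \<noteq> snd e" if "e \<in> parcs ?G" for e
    using card_nbrs(1)[OF assms] that by (auto simp: cycle_matching_graph_def)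
  moreover have "pverts ?G = {..<2*h}"
    by (simp add: cycle_matching_graph_def)
  ultimately have "pair_graph ?G"
    using arcs by unfold_locales (auto simp: symmetric_def arcs_ends_conv)
  moreover have "out_degree (with_proj ?G) v = 3" if "v < 2*h" for v
  proof -
    have "out_arcs (with_proj ?G) v = Pair v ` nbrs h \<tau> v"
      using that by (auto simp: out_arcs_def cycle_matching_graph_def)
    then show ?thesis
      using card_nbrs(2)[OF assms that] by (simp add: out_degree_def card_image inj_on_def)
  qed
  ultimately show ?thesis
    by (simp add: regular_graph_def cycle_matching_graph_def)
qed

text \<open>Consecutive numbers are adjacent on the cycle, so an interval \<open>K\<close> is a
  path; walking up and down from a vertex in \<open>X\<close> never leaves \<open>X\<close>.\<close>

lemma closed_off_convex:
  assumes cl: "closed_off (cycle_matching_graph h \<tau>) C X" and K: "K \<subseteq> {..<2*h}" "K \<inter> C = {}" "K \<inter> X \<noteq> {}"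
    and conv: "\<And>x y z. \<lbrakk>x \<in> K; y \<in> K; x \<le> z; z \<le> y\<rbrakk> \<Longrightarrow> z \<in> K"
  shows "K \<subseteq> X"
proof
  obtain x where x: "x \<in> K" "x \<in> X" using K(3) by blast
  have next_in: "z' \<in> X" if "z \<in> X" "z \<in> K" "z' \<in> K" "z' = Suc z \<or> z = Suc z'" for z z'
  proof -
    have "z < 2*h" "z' < 2*h" "z' \<notin> C"
      using K(1,2) that(2,3) by auto
    then have "(z, z') \<in> parcs (cycle_matching_graph h \<tau>)"
      using that(4) by (auto simp: cycle_matching_graph_def nbrs_def)
    then show ?thesis
      using cl \<open>z' \<notin> C\<close> that(1) unfolding closed_off_def by blast
  qed
  fix y assume y: "y \<in> K"
  show "y \<in> X"
  proof (cases "x \<le> y")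
    case True
    have "z \<le> y \<longrightarrow> z \<in> X" if "x \<le> z" for z
      using that
    proof (induction z rule: dec_induct)
      case (step z)
      then show ?case
        using next_in[of z "Suc z"] conv[OF x(1) y] by auto
    qed (use x in auto)
    with True show ?thesis by blast
  next
    case False
    then have "y \<le> x" by simp
    have "y \<le> z \<longrightarrow> z \<in> X" if "z \<le> x" for z
      using that
    proof (induction z rule: inc_induct)
      case (step z)
      then show ?case
        using next_in[of "Suc z" z] conv[OF y x(1)] by auto
    qed (use x in auto)
    with \<open>y \<le> x\<close> show ?thesis by blast
  qed
qed

section \<open>Assembly of the graph and the linear bound\<close>

lemma exists_cubic_graph_not_cops_win:
  assumes s: "0 < s" and h: "80 * s < h"
  obtains G :: "nat pair_pre_digraph" where "regular_graph 3 G" "card (pverts G) = 2*h"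
    "\<And>k. 2 * Suc k \<le> s \<Longrightarrow> \<not> cops_win G k"
proof -
  let ?N = "80 * s"
  obtain f where f: "f \<in> {..<?N} \<rightarrow> {..<4*s}"
    and link: "\<And>S T. \<lbrakk>S \<subseteq> {..<4*s}; T \<subseteq> {..<4*s}; s \<le> card S; s \<le> card T\<rbrakk> \<Longrightarrow>
      \<exists>x<?N. x div 20 \<in> S \<and> f x \<in> T"
    using exists_linking_function[OF s] by metis
  obtain \<tau> where \<tau>: "\<tau> permutes {..<?N}" and mono: "mono_on {..<?N} (f \<circ> \<tau>)"
    using exists_sorting_permutation by blast
  have \<tau>h: "\<tau> permutes {..<h}"
    using \<tau> by (rule permutes_subset) (use h in auto)
  \<comment> \<open>The strict bound \<open>80 * s < h\<close> puts \<open>h - 1\<close> outside the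
    range that \<open>\<tau>\<close> permutes.\<close>
  have fixed: "\<tau> (h - 1) = h - 1"
    using \<tau> by (rule permutes_not_in) (use h in auto)
  let ?G = "cycle_matching_graph h \<tau>"
  have reg: "regular_graph 3 ?G"
    using \<tau>h fixed s h by (intro regular_cycle_matching_graph) auto
  define A where "A i = {x. x < ?N \<and> x div 20 = i}" for i
  \<comment> \<open>The second half is grouped by the value of \<open>f\<close> at the matching
    partner; as \<open>f \<circ> \<tau>\<close> is monotone, each group is an interval.\<close>
  define B where "B j = {h + p | p. p < ?N \<and> f (\<tau> p) = j}" for j
  have A_verts: "A i \<subseteq> {..<2*h}" and B_verts: "B i \<subseteq> {..<2*h}" for i
    using h by (auto simp: A_def B_def)
  have convA: "z \<in> A i" if "x \<in> A i" "y \<in> A i" "x \<le> z" "z \<le> y" for i x y z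
    using that div_le_mono[of x z 20] div_le_mono[of z y 20] by (auto simp: A_def)
  have convB: "z \<in> B j" if xy: "x \<in> B j" "y \<in> B j" "x \<le> z" "z \<le> y" for j x y z
  proof -
    obtain p q where pq: "x = h + p" "y = h + q" "p < ?N" "q < ?N" "f (\<tau> p) = j" "f (\<tau> q) = j"
      using xy(1,2) by (auto simp: B_def)
    have "f (\<tau> p) \<le> f (\<tau> (z - h))" "f (\<tau> (z - h)) \<le> f (\<tau> q)"
      using mono_onD[OF mono, of p "z - h"] mono_onD[OF mono, of "z - h" q] pq xy(3,4) by auto
    then show ?thesis
      using pq xy(3,4) unfolding B_def by (auto intro!: exI[of _ "z - h"])
  qed
  interpret pair_graph ?G
    using reg by (simp add: regular_graph_def)
  interpret linked_families ?G A B s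
  proof
    show "disjoint_family_on A {..<4*s}" "disjoint_family_on B {..<4*s}"
      by (auto simp: disjoint_family_on_def A_def B_def)
    show "A i \<subseteq> X" if "closed_off ?G C X" "A i \<inter> C = {}" "A i \<inter> X \<noteq> {}" for i C X
      using that(1) A_verts that(2,3) convA by (rule closed_off_convex)
    show "B i \<subseteq> X" if "closed_off ?G C X" "B i \<inter> C = {}" "B i \<inter> X \<noteq> {}" for i C X
      using that(1) B_verts that(2,3) convB by (rule closed_off_convex)
    show "A i \<subseteq> pverts ?G" for i
      using A_verts by (simp add: cycle_matching_graph_def)
    fix S T assume "S \<subseteq> {..<4*s}" "T \<subseteq> {..<4*s}" "s \<le> card S" "s \<le> card T"
    then obtain x where x: "x < ?N" "x div 20 \<in> S" "f x \<in> T"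
      using link by blast
    have "inv \<tau> x < ?N"
      using permutes_in_image[OF permutes_inv[OF \<tau>], of x] x(1) by simp
    then have "x \<in> A (x div 20)" "h + inv \<tau> x \<in> B (f x)"
      using x(1) permutes_inverses(1)[OF \<tau>] by (auto simp: A_def B_def)
    moreover have "(x, h + inv \<tau> x) \<in> parcs ?G"
      using x(1) h by (auto simp: cycle_matching_graph_def nbrs_def matched_def)
    ultimately show "\<exists>i\<in>S. \<exists>j\<in>T. \<exists>x\<in>A i. \<exists>y\<in>B j. (x, y) \<in> parcs ?G"
      using x(2,3) by blast
  qed (use s in auto)
  show ?thesis
    using that[OF reg _ not_cops_win] by (simp add: cycle_matching_graph_def)
qed

theorem corollary1:
  shows "\<exists>\<alpha>::real. \<alpha> > 0 \<and>
    (\<exists>n\<^sub>0::nat. \<forall>n\<ge>n\<^sub>0. even n \<longrightarrow>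
      (\<exists>G :: nat pair_pre_digraph.
         regular_graph 3 G \<and> card (pverts G) = n \<and> real (ent G) > \<alpha> * real n))"
proof (intro exI[of _ "1/1000 :: real"] conjI exI[of _ "1000 :: nat"] allI impI)
  fix n :: nat assume n: "1000 \<le> n" "even n"
  obtain h where h: "n = 2 * h" using n(2) by blast
  \<comment> \<open>This is the largest \<open>s\<close> with \<open>80 * s < h\<close>.\<close>
  define s where "s = (h - 1) div 80"
  have s: "0 < s" "80 * s < h" "h \<le> 80 * s + 80"
    using n h by (auto simp: s_def)
  obtain G :: "nat pair_pre_digraph" where G: "regular_graph 3 G" "card (pverts G) = 2*h"
    "\<And>k. 2 * Suc k \<le> s \<Longrightarrow> \<not> cops_win G k"
    using exists_cubic_graph_not_cops_win[OF s(1,2)] by metis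
  \<comment> \<open>Since some number of cops wins, the minimum is attained, and the lower bound
    applies to \<open>ent G\<close> itself.\<close>
  have "cops_win G (ent G)"
    unfolding ent_def using G(1) cops_win_card by (intro LeastI) (auto simp: regular_graph_def)
  then have "\<not> 2 * Suc (ent G) \<le> s" using G(3) by blast
  then have "s \<le> 2 * ent G + 1" by simp
  \<comment> \<open>The estimates give \<open>n \<le> 320 * ent G + 320\<close>; for
    \<open>n \<ge> 1000\<close> the factor 1000 absorbs the additive term.\<close>
  then have "n < 1000 * ent G"
    using s(3) n(1) h by linarith
  then have "real n < 1000 * real (ent G)"
    by linarith
  then show "\<exists>G :: nat pair_pre_digraph. regular_graph 3 G \<and> card (pverts G) = n \<and>
      real (ent G) > 1/1000 * real n"
    using G(1,2) h by (intro exI[of _ G]) auto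
qed simp

end
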